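(* For every sufficiently large $n$, there exists a function $\rho : \mathcal{S}_n \to \mathbb{R}_{\geq 0}$ such that $\sum_{\sigma \in \mathcal{S}_n : c_{ij} \in \sigma} \rho(\sigma) \geq 1$ for all $i,j \in \{1,\dots,n\}$ and \[ \sum_{\sigma \in \mathcal{S}_n} \rho(\sigma) < 0.925\, n . \] In particular, the optimal value of the linear program (LP$_c$) is less than $0.925\,n$.
   Context: For $n \geq 1$, $Q_n$ is the $n\times n$ chessboard in $[-1,1]^2$ whose cells are the closed squares $c_{ij} = \left[-1+(i-1)\frac 2n, -1+i\frac 2n\right] \times \left[-1+(j-1)\frac 2n, -1+j\frac 2n\right]$ for $i,j \in \{1,\dots,n\}$. A line $\ell$ pierces $c_{ij}$ if $\ell \cap \operatorname{int} c_{ij} \neq \emptyset$. For a line $\ell$, its snake $\sigma(\ell)$ is the set of cells of $Q_n$ pierced by $\ell$. Let $\mathcal{S}_n = \{\sigma(\ell) : \ell \text{ a line intersecting } [-1,1]^2\}$. The linear program (LP$_c$) is: minimize $\sum_{\sigma\in\mathcal{S}_n} \rho(\sigma)$ subject to $\rho(\sigma)\geq 0$ for all $\sigma$ and $\sum_{\sigma \ni c_{ij}} \rho(\sigma) \geq 1$ for every cell $c_{ij}$. *)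

theory Defs
  imports "HOL-Analysis.Analysis"
begin

definition is_line :: "(real \<times> real) set \<Rightarrow> bool" where
  "is_line l \<longleftrightarrow> affine l \<and> aff_dim l = 1"

definition cell :: "nat \<Rightarrow> nat \<Rightarrow> nat \<Rightarrow> (real \<times> real) set" where
  "cell n i j =
     {-1 + (real i - 1) * (2 / real n) .. -1 + real i * (2 / real n)} \<times>
     {-1 + (real j - 1) * (2 / real n) .. -1 + real j * (2 / real n)}"

definition chessboard :: "nat \<Rightarrow> (real \<times> real) set set" where
  "chessboard n = {cell n i j | i j. i \<in> {1..n} \<and> j \<in> {1..n}}"

definition pierces :: "(real \<times> real) set \<Rightarrow> (real \<times> real) set \<Rightarrow> bool" where
  "pierces l c \<longleftrightarrow> l \<inter> interior c \<noteq> {}"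

definition snake :: "nat \<Rightarrow> (real \<times> real) set \<Rightarrow> (real \<times> real) set set" where
  "snake n l = {c \<in> chessboard n. pierces l c}"

definition snakes :: "nat \<Rightarrow> (real \<times> real) set set set" where
  "snakes n = {snake n l | l. is_line l \<and> l \<inter> ({-1..1} \<times> {-1..1}) \<noteq> {}}"

text \<open>Snakes form a finite family, so that the sums below are genuine finite sums.\<close>

lemma finite_chessboard: "finite (chessboard n)"
  unfolding chessboard_def by (rule finite_image_set2) simp_all

lemma finite_snakes: "finite (snakes n)"
proof (rule finite_subset)
  show "snakes n \<subseteq> Pow (chessboard n)"
    by (auto simp: snakes_def snake_def)
  show "finite (Pow (chessboard n))"
    by (simp add: finite_chessboard)
qed

text \<open>Only the values of the weight on \<^term>\<open>snakes n\<close> matter; elsewhere it is unconstrained.\<close>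

definition LPc_feasible :: "nat \<Rightarrow> ((real \<times> real) set set \<Rightarrow> real) set" where
  "LPc_feasible n = {\<rho>. \<rho> \<in> snakes n \<rightarrow> {0..} \<and>
     (\<forall>i\<in>{1..n}. \<forall>j\<in>{1..n}. (\<Sum>\<sigma> | \<sigma> \<in> snakes n \<and> cell n i j \<in> \<sigma>. \<rho> \<sigma>) \<ge> 1)}"

definition LPc_objective :: "nat \<Rightarrow> ((real \<times> real) set set \<Rightarrow> real) \<Rightarrow> real" where
  "LPc_objective n \<rho> = (\<Sum>\<sigma>\<in>snakes n. \<rho> \<sigma>)"

text \<open>The infimum is taken in the extended reals, so that an infeasible program would have
  value \<open>\<infinity>\<close>.\<close>

definition LPc_value :: "nat \<Rightarrow> ereal" where
  "LPc_value n = (INF \<rho>\<in>LPc_feasible n. ereal (LPc_objective n \<rho>))"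

end

theory Submission
  imports Defs
begin

text \<open>
  Four families of parallel lines suffice: the axis-parallel lines through the centres of the
  cells, and the lines of slope \<open>\<plusminus>1\<close> that meet the axes at odd multiples of \<open>1/n\<close>.
  In coordinates scaled by \<open>n\<close>, cell centres have integer coordinates \<open>(a, b)\<close> and a cell is
  pierced by the axis-parallel lines with offsets \<open>a\<close> and \<open>b\<close> and by the diagonal lines with
  offsets \<open>a + b \<plusminus> 1\<close> and \<open>a - b \<plusminus> 1\<close>.  Axis-parallel lines get weight \<open>1/4\<close> outside the middle
  half of the board and \<open>0\<close> inside it; a diagonal line of offset \<open>t\<close> gets weight \<open>1/4\<close> if
  \<open>\<bar>t\<bar> \<le> n\<close>, weight \<open>1/8\<close> if \<open>n < \<bar>t\<bar> \<le> 3n/2\<close>, and \<open>0\<close> otherwise.  The total weight is at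
  most \<open>7n/8 + 1\<close>.
\<close>

section \<open>Weighted families of lines\<close>

text \<open>Distinct lines may share a snake, so each snake receives the total weight of the lines
  inducing it. Both sums are then regrouped by the snake of each line.\<close>

lemma snake_weights_of_lines:
  fixes w :: "'i \<Rightarrow> real"
  assumes fin: "finite I"
    and line: "\<forall>i\<in>I. is_line (l i)"
    and meet: "\<forall>i\<in>I. l i \<inter> ({-1..1} \<times> {-1..1}) \<noteq> {}"
    and nonneg: "\<forall>i\<in>I. 0 \<le> w i"
  obtains \<rho> where "\<rho> \<in> snakes n \<rightarrow> {0..}"
    and "(\<Sum>\<sigma>\<in>snakes n. \<rho> \<sigma>) = sum w I"
    and "\<And>c. (\<Sum>\<sigma> | \<sigma> \<in> snakes n \<and> c \<in> \<sigma>. \<rho> \<sigma>) = sum w {i \<in> I. c \<in> snake n (l i)}"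
proof
  define \<rho> where "\<rho> \<sigma> = sum w {i \<in> I. snake n (l i) = \<sigma>}" for \<sigma>
  have snakes: "snake n (l i) \<in> snakes n" if "i \<in> I" for i
    using that line meet by (auto simp: snakes_def)
  show "\<rho> \<in> snakes n \<rightarrow> {0..}"
    by (auto simp: \<rho>_def intro!: sum_nonneg bspec[OF nonneg])
  show "(\<Sum>\<sigma>\<in>snakes n. \<rho> \<sigma>) = sum w I"
    unfolding \<rho>_def by (rule sum.group) (use fin finite_snakes snakes in auto)
  show "(\<Sum>\<sigma> | \<sigma> \<in> snakes n \<and> c \<in> \<sigma>. \<rho> \<sigma>) = sum w {i \<in> I. c \<in> snake n (l i)}" for c
  proof -
    \<comment> \<open>A line with snake \<open>\<sigma>\<close> has \<open>c\<close> in its snake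
      because \<open>c \<in> \<sigma>\<close>, so filtering the index set by this changes
      nothing.\<close>
    have "(\<Sum>\<sigma> | \<sigma> \<in> snakes n \<and> c \<in> \<sigma>. \<rho> \<sigma>) =
      (\<Sum>\<sigma> | \<sigma> \<in> snakes n \<and> c \<in> \<sigma>.
         sum w {i \<in> {i \<in> I. c \<in> snake n (l i)}. snake n (l i) = \<sigma>})"
      unfolding \<rho>_def by (intro sum.cong) auto
    also have "\<dots> = sum w {i \<in> I. c \<in> snake n (l i)}"
      by (rule sum.group) (use fin finite_snakes snakes in auto)
    finally show ?thesis .
  qed
qed

section \<open>Lines with integer coefficients\<close>

text \<open>\<open>d\<close> is a normal vector, so \<open>(1, 0)\<close> yields vertical lines.
  Dividing \<open>t\<close> by \<open>n\<close> makes the offset an integer in the scaled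
  coordinates.\<close>

definition lattice_line :: "nat \<Rightarrow> int \<times> int \<Rightarrow> int \<Rightarrow> (real \<times> real) set" where
  "lattice_line n d t =
     {z. (real_of_int (fst d), real_of_int (snd d)) \<bullet> z = real_of_int t / real n}"

lemma is_line_lattice_line:
  assumes "d \<noteq> 0"
  shows "is_line (lattice_line n d t)"
proof -
  have "(real_of_int (fst d), real_of_int (snd d)) \<noteq> 0"
    using assms by (auto simp: zero_prod_def prod_eq_iff)
  then show ?thesis
    by (simp add: is_line_def lattice_line_def affine_hyperplane aff_dim_hyperplane)
qed

text \<open>The cell \<open>cell n i j\<close> is centred at \<open>(a/n, b/n)\<close> with \<open>a = 2i - 1 - n\<close>, \<open>b = 2j - 1 - n\<close>,
  and has half-width \<open>1/n\<close>.\<close>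

lemma interior_cell:
  assumes "n > 0" and "a = 2 * real i - 1 - real n" and "b = 2 * real j - 1 - real n"
  shows "interior (cell n i j) = {(a - 1) / n <..< (a + 1) / n} \<times> {(b - 1) / n <..< (b + 1) / n}"
proof -
  have "-1 + (real k - 1) * (2 / real n) = (2 * real k - 1 - real n - 1) / n"
    "-1 + real k * (2 / real n) = (2 * real k - 1 - real n + 1) / n" for k
    using assms(1) by (simp_all add: field_simps)
  then show ?thesis
    by (simp only: cell_def interior_Times interior_atLeastAtMost_real assms)
qed

text \<open>On the open square of half-width 1 about \<open>(a, b)\<close>, the form
  \<open>p * x + q * y\<close> takes exactly the values within
  \<open>\<bar>p\<bar> + \<bar>q\<bar>\<close> of its value at the centre. All of them occur on the
  diagonal or midline through the centre along \<open>(sgn p, sgn q)\<close>.\<close>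

lemma lattice_line_pierces_cell:
  assumes n: "n > 0"
    and near: "\<bar>t - (p * (2 * int i - 1 - int n) + q * (2 * int j - 1 - int n))\<bar> < \<bar>p\<bar> + \<bar>q\<bar>"
  shows "pierces (lattice_line n (p, q) t) (cell n i j)"
proof -
  define a where "a = 2 * int i - 1 - int n"
  define b where "b = 2 * int j - 1 - int n"
  define m where "m = real_of_int (\<bar>p\<bar> + \<bar>q\<bar>)"
  define s where "s = real_of_int (t - (p * a + q * b)) / m"
  have m: "m > 0"
    using near by (simp add: m_def)
  have "\<bar>real_of_int (t - (p * a + q * b))\<bar> < m"
    using near unfolding a_def b_def m_def by linarith
  then have "\<bar>s\<bar> < 1"
    using m by (simp add: s_def)
  then have s: "-1 < s" "s < 1"
    by auto
  define x where "x = (real_of_int a + s * real_of_int (sgn p)) / n"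
  define y where "y = (real_of_int b + s * real_of_int (sgn q)) / n"
  have "s * m = real_of_int t - (p * a + q * b)"
    using m by (simp add: s_def)
  moreover have "real_of_int p * sgn p + real_of_int q * sgn q = m"
    by (simp add: m_def sgn_if)
  ultimately have "real_of_int p * (a + s * sgn p) + real_of_int q * (b + s * sgn q) = t"
    by (simp add: algebra_simps flip: distrib_left)
  then have "real_of_int p * x + real_of_int q * y = t / n"
    by (simp add: x_def y_def flip: add_divide_distrib)
  then have "(x, y) \<in> lattice_line n (p, q) t"
    by (simp add: lattice_line_def)
  moreover have "(x, y) \<in> interior (cell n i j)"
  proof -
    have "\<bar>s * real_of_int (sgn p)\<bar> < 1" "\<bar>s * real_of_int (sgn q)\<bar> < 1"
      using s by (auto simp: sgn_if)
    then show ?thesis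
      using n by (subst interior_cell[where a = a and b = b])
        (auto simp: x_def y_def a_def b_def intro!: divide_strict_right_mono)
  qed
  ultimately show ?thesis
    by (auto simp: pierces_def)
qed

text \<open>The same argument for the closed board centred at the origin, with a point
  \<open>s * (sgn p, sgn q)\<close> as witness.\<close>

lemma lattice_line_meets_board:
  assumes n: "n > 0" and d: "(p, q) \<noteq> (0, 0)" and t: "\<bar>t\<bar> \<le> int n * (\<bar>p\<bar> + \<bar>q\<bar>)"
  shows "lattice_line n (p, q) t \<inter> ({-1..1} \<times> {-1..1}) \<noteq> {}"
proof -
  define m where "m = real_of_int (\<bar>p\<bar> + \<bar>q\<bar>)"
  define s where "s = real_of_int t / (real n * m)"
  have m: "m > 0"
    using d by (auto simp: m_def)
  have "\<bar>real_of_int t\<bar> \<le> real n * m"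
    using of_int_le_iff[of "\<bar>t\<bar>" "int n * (\<bar>p\<bar> + \<bar>q\<bar>)", where ?'a = real] t by (simp add: m_def)
  then have "\<bar>s\<bar> \<le> 1"
    using m n by (simp add: s_def)
  then have s: "-1 \<le> s" "s \<le> 1"
    by auto
  have "real_of_int p * sgn p + real_of_int q * sgn q = m"
    by (simp add: m_def sgn_if)
  then have "real_of_int p * (s * sgn p) + real_of_int q * (s * sgn q) = s * m"
    by (simp add: algebra_simps flip: distrib_left)
  also have "\<dots> = t / n"
    using m n by (simp add: s_def)
  finally have "(s * sgn p, s * sgn q) \<in> lattice_line n (p, q) t"
    by (simp add: lattice_line_def)
  moreover have "(s * sgn p, s * sgn q) \<in> {-1..1} \<times> {-1..1}"
    using s by (auto simp: sgn_if)
  ultimately show ?thesis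
    by blast
qed

section \<open>Counting integers of one parity in an interval\<close>

lemma card_parity_interval_le:
  fixes x y :: real and c :: int
  assumes "x \<le> y"
  shows "real (card {t::int. x \<le> t \<and> t \<le> y \<and> odd (t + c)}) \<le> (y - x) / 2 + 1"
proof -
  \<comment> \<open>\<open>r\<close> is the residue mod 2 forced on \<open>t\<close>, so the
    admissible \<open>t\<close> are the numbers \<open>2 * k + r\<close> and counting them reduces
    to counting \<open>k\<close>.\<close>
  define r where "r = (c + 1) mod 2"
  define u where "u = \<lceil>(x - r) / 2\<rceil>"
  define v where "v = \<lfloor>(y - r) / 2\<rfloor>"
  have "{t::int. x \<le> t \<and> t \<le> y \<and> odd (t + c)} \<subseteq> (\<lambda>m. 2 * m + r) ` {u..v}"
  proof
    fix t :: int
    assume "t \<in> {t. x \<le> t \<and> t \<le> y \<and> odd (t + c)}"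
    then have t: "x \<le> t" "t \<le> y" "odd (t + c)"
      by auto
    have "t = 2 * (t div 2) + r"
      using t(3) unfolding r_def by presburger
    then obtain k where k: "t = 2 * k + r"
      by blast
    with t have "k \<in> {u..v}"
      by (auto simp: u_def v_def ceiling_le_iff le_floor_iff)
    with k show "t \<in> (\<lambda>m. 2 * m + r) ` {u..v}"
      by blast
  qed
  then have "real (card {t::int. x \<le> t \<and> t \<le> y \<and> odd (t + c)}) \<le> card {u..v}"
    by (intro of_nat_mono surj_card_le) auto
  moreover have "real (card {u..v}) \<le> (y - x) / 2 + 1"
  proof (cases "u \<le> v")
    case True
    have "real_of_int v - u \<le> (y - x) / 2"
      using of_int_floor_le[of "(y - r) / 2"] le_of_int_ceiling[of "(x - r) / 2"]
      unfolding u_def v_def by argo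
    with True show ?thesis
      by simp
  qed (use assms in simp)
  ultimately show ?thesis
    by (rule order_trans)
qed

section \<open>The four families\<close>

definition dirs :: "(int \<times> int) set" where
  "dirs = {(1, 0), (0, 1), (1, 1), (1, -1)}"

text \<open>Centres have coordinates of the parity of \<open>n + 1\<close>. The parity condition
  thus selects axis-parallel lines through centres, but odd offsets for both diagonal normals, where
  \<open>n * (p + q)\<close> is even.\<close>

definition offsets :: "nat \<Rightarrow> int \<times> int \<Rightarrow> int set" where
  "offsets n d = {t. \<bar>t\<bar> < int n * (\<bar>fst d\<bar> + \<bar>snd d\<bar>) \<and> odd (t + int n * (fst d + snd d))}"

definition axis_weight :: "nat \<Rightarrow> int \<Rightarrow> real" where
  "axis_weight n t = (if int n \<le> 2 * \<bar>t\<bar> then 1/4 else 0)"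

text \<open>Writing the three-valued weight as two steps of height 1/8 lets its sum be bounded by
  two interval counts.\<close>

definition diag_weight :: "nat \<Rightarrow> int \<Rightarrow> real" where
  "diag_weight n t =
     (if \<bar>t\<bar> \<le> int n then 1/8 else 0) + (if 2 * \<bar>t\<bar> \<le> 3 * int n then 1/8 else 0)"

definition line_weight :: "nat \<Rightarrow> (int \<times> int) \<times> int \<Rightarrow> real" where
  "line_weight n = (\<lambda>((p, q), t). if p * q = 0 then axis_weight n t else diag_weight n t)"

lemma line_weight_nonneg: "0 \<le> line_weight n i"
  by (auto simp: line_weight_def axis_weight_def diag_weight_def split: prod.split)

lemma finite_offsets: "finite (offsets n d)"
  by (rule finite_subset[of _ "{- (int n * (\<bar>fst d\<bar> + \<bar>snd d\<bar>)) .. int n * (\<bar>fst d\<bar> + \<bar>snd d\<bar>)}"])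
    (auto simp: offsets_def)

section \<open>The covering inequality\<close>

text \<open>One diagonal pair always contributes 1/2. The other half comes from the second pair if
  both coordinates are in the middle half, from the axis lines if both are outside, and otherwise as
  1/4 from one axis line and at least 1/8 from each line of the second pair.\<close>

lemma weights_cover:
  fixes a b :: int
  assumes "\<bar>a\<bar> < int n" "\<bar>b\<bar> < int n"
  shows "1 \<le> axis_weight n a + axis_weight n b
    + diag_weight n (a + b - 1) + diag_weight n (a + b + 1)
    + diag_weight n (a - b - 1) + diag_weight n (a - b + 1)"
proof -
  \<comment> \<open>For equal signs \<open>a - b\<close>, and for opposite signs
    \<open>a + b\<close>, is no larger in absolute value than the larger of
    \<open>\<bar>a\<bar>\<close> and \<open>\<bar>b\<bar>\<close>, hence at most
    \<open>n - 1\<close>.\<close>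
  have near: "\<bar>a - b - 1\<bar> \<le> int n \<and> \<bar>a - b + 1\<bar> \<le> int n \<or>
      \<bar>a + b - 1\<bar> \<le> int n \<and> \<bar>a + b + 1\<bar> \<le> int n"
  proof (cases "a \<ge> 0 \<longleftrightarrow> b \<ge> 0")
    case True
    with assms have "\<bar>a - b\<bar> + 1 \<le> int n"
      by linarith
    then show ?thesis
      by linarith
  next
    case False
    with assms have "\<bar>a + b\<bar> + 1 \<le> int n"
      by linarith
    then show ?thesis
      by linarith
  qed
  have diag: "diag_weight n t = 1/4" if "\<bar>t\<bar> \<le> int n" for t
    using that by (simp add: diag_weight_def)
  have diag': "1/8 \<le> diag_weight n (s - 1)" "1/8 \<le> diag_weight n (s + 1)"
    if "2 * \<bar>s\<bar> + 2 \<le> 3 * int n" for s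
  proof -
    have "2 * \<bar>s - 1\<bar> \<le> 3 * int n" "2 * \<bar>s + 1\<bar> \<le> 3 * int n"
      using that by presburger+
    then show "1/8 \<le> diag_weight n (s - 1)" "1/8 \<le> diag_weight n (s + 1)"
      by (simp_all add: diag_weight_def)
  qed
  have near': "diag_weight n (a - b - 1) = 1/4 \<and> diag_weight n (a - b + 1) = 1/4 \<or>
      diag_weight n (a + b - 1) = 1/4 \<and> diag_weight n (a + b + 1) = 1/4"
    using near diag by blast
  have nonneg: "0 \<le> diag_weight n t" "0 \<le> axis_weight n t" for t
    by (simp_all add: diag_weight_def axis_weight_def)
  \<comment> \<open>In the mixed case integrality even gives \<open>3 * int n - 3\<close>; the slack
    of 2 absorbs the shifts by 1 in the diagonal offsets.\<close>
  consider "2 * \<bar>a\<bar> < int n" "2 * \<bar>b\<bar> < int n"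
    | "int n \<le> 2 * \<bar>a\<bar>" "int n \<le> 2 * \<bar>b\<bar>"
    | "axis_weight n a + axis_weight n b = 1/4" "2 * \<bar>a\<bar> + 2 * \<bar>b\<bar> \<le> 3 * int n - 2"
    using assms by (force simp: axis_weight_def)
  then show ?thesis
  proof cases
    case 1
    then have "\<bar>a + b - 1\<bar> \<le> int n" "\<bar>a + b + 1\<bar> \<le> int n"
      "\<bar>a - b - 1\<bar> \<le> int n" "\<bar>a - b + 1\<bar> \<le> int n"
      by linarith+
    then show ?thesis
      using nonneg(2)[of a] nonneg(2)[of b] by (simp add: diag)
  next
    case 2
    then have "axis_weight n a = 1/4" "axis_weight n b = 1/4"
      by (simp_all add: axis_weight_def)
    with near' show ?thesis
      using nonneg(1)[of "a + b - 1"] nonneg(1)[of "a + b + 1"]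
        nonneg(1)[of "a - b - 1"] nonneg(1)[of "a - b + 1"]
      by linarith
  next
    case 3
    have "2 * \<bar>a + b\<bar> + 2 \<le> 3 * int n"
      using abs_triangle_ineq[of a b, THEN mult_left_mono, of 2] 3(2) by simp
    moreover have "2 * \<bar>a - b\<bar> + 2 \<le> 3 * int n"
      using abs_triangle_ineq4[of a b, THEN mult_left_mono, of 2] 3(2) by simp
    ultimately have "1/8 \<le> diag_weight n (a + b - 1)" "1/8 \<le> diag_weight n (a + b + 1)"
      "1/8 \<le> diag_weight n (a - b - 1)" "1/8 \<le> diag_weight n (a - b + 1)"
      by (simp_all only: diag')
    with near' 3(1) show ?thesis
      by linarith
  qed
qed

section \<open>Bounding the total weight\<close>

lemma sum_if_eq_card:
  fixes c :: real
  assumes "finite A"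
  shows "(\<Sum>t\<in>A. if P t then c else 0) = c * card {t \<in> A. P t}"
  using assms by (simp add: sum.If_cases Int_def)

lemma sum_axis_weight_le:
  assumes "n \<ge> 2"
  shows "sum (axis_weight n) {t. \<bar>t\<bar> < int n \<and> odd (t + c)} \<le> real n / 8 + 1/4"
proof -
  let ?S = "\<lambda>x y. {t::int. x \<le> real_of_int t \<and> real_of_int t \<le> y \<and> odd (t + c)}"
  let ?A = "{t. \<bar>t\<bar> < int n \<and> odd (t + c)}"
  have fin: "finite ?A"
    by (rule finite_subset[of _ "{- int n..int n}"]) auto
  have fin': "finite (?S x y)" for x y
    by (rule finite_subset[of _ "{\<lfloor>x\<rfloor>..\<lceil>y\<rceil>}"]) (auto simp: floor_le_iff le_ceiling_iff)
  \<comment> \<open>Each of the two outer intervals has length \<open>n / 2 - 1\<close>, nonnegative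
    as \<open>n \<ge> 2\<close>, and so holds at most \<open>n / 4 + 1/2\<close> offsets.\<close>
  have "{t \<in> ?A. int n \<le> 2 * \<bar>t\<bar>} \<subseteq> ?S (real n / 2) (real n - 1) \<union> ?S (1 - real n) (- (real n / 2))"
  proof
    fix t
    assume "t \<in> {t \<in> ?A. int n \<le> 2 * \<bar>t\<bar>}"
    then have "odd (t + c)" "\<bar>t\<bar> \<le> int n - 1" "int n \<le> 2 * \<bar>t\<bar>"
      by auto
    then show "t \<in> ?S (real n / 2) (real n - 1) \<union> ?S (1 - real n) (- (real n / 2))"
      by simp linarith
  qed
  then have "card {t \<in> ?A. int n \<le> 2 * \<bar>t\<bar>} \<le> card (?S (real n / 2) (real n - 1)) + card (?S (1 - real n) (- (real n / 2)))"
    using fin' by (meson card_Un_le card_mono finite_UnI le_trans)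
  moreover have "real (card (?S (real n / 2) (real n - 1))) \<le> (real n - 1 - real n / 2) / 2 + 1"
    using assms by (intro card_parity_interval_le) auto
  moreover have "real (card (?S (1 - real n) (- (real n / 2)))) \<le> (- (real n / 2) - (1 - real n)) / 2 + 1"
    using assms by (intro card_parity_interval_le) auto
  ultimately have "real (card {t \<in> ?A. int n \<le> 2 * \<bar>t\<bar>}) \<le> real n / 2 + 1"
    by (simp add: field_simps)
  then show ?thesis
    unfolding axis_weight_def using fin by (simp add: sum_if_eq_card)
qed

text \<open>The two steps cover at most \<open>n + 1\<close> and \<open>3 * n / 2 + 1\<close>
  offsets, each counted with 1/8.\<close>

lemma sum_diag_weight_le:
  "sum (diag_weight n) {t. \<bar>t\<bar> < 2 * int n \<and> odd (t + c)} \<le> 5 * real n / 16 + 1/4"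
proof -
  let ?S = "\<lambda>x y. {t::int. x \<le> real_of_int t \<and> real_of_int t \<le> y \<and> odd (t + c)}"
  let ?A = "{t. \<bar>t\<bar> < 2 * int n \<and> odd (t + c)}"
  have fin: "finite ?A"
    by (rule finite_subset[of _ "{- 2 * int n..2 * int n}"]) auto
  have fin': "finite (?S x y)" for x y
    by (rule finite_subset[of _ "{\<lfloor>x\<rfloor>..\<lceil>y\<rceil>}"]) (auto simp: floor_le_iff le_ceiling_iff)
  have "card {t \<in> ?A. \<bar>t\<bar> \<le> int n} \<le> card (?S (- real n) (real n))"
    by (intro card_mono fin') auto
  moreover have "real (card (?S (- real n) (real n))) \<le> (real n - - real n) / 2 + 1"
    by (intro card_parity_interval_le) auto
  moreover have "card {t \<in> ?A. 2 * \<bar>t\<bar> \<le> 3 * int n} \<le> card (?S (- (3 * real n / 2)) (3 * real n / 2))"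
    by (intro card_mono fin') auto
  moreover have "real (card (?S (- (3 * real n / 2)) (3 * real n / 2))) \<le> (3 * real n / 2 - - (3 * real n / 2)) / 2 + 1"
    by (intro card_parity_interval_le) auto
  ultimately show ?thesis
    unfolding diag_weight_def using fin by (simp add: sum_if_eq_card sum.distrib)
qed

lemma sum_line_weight_le:
  assumes "n \<ge> 2"
  shows "sum (line_weight n) (Sigma dirs (offsets n)) \<le> 7 * real n / 8 + 1"
proof -
  have "sum (line_weight n) (Sigma dirs (offsets n)) =
      (\<Sum>d\<in>dirs. \<Sum>t\<in>offsets n d. line_weight n (d, t))"
    by (subst sum.Sigma) (auto simp: dirs_def finite_offsets)
  also have "\<dots> = 2 * sum (axis_weight n) {t. \<bar>t\<bar> < int n \<and> odd (t + int n)}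
      + sum (diag_weight n) {t. \<bar>t\<bar> < 2 * int n \<and> odd (t + 2 * int n)}
      + sum (diag_weight n) {t. \<bar>t\<bar> < 2 * int n \<and> odd (t + 0)}"
    by (simp add: dirs_def offsets_def line_weight_def mult.commute)
  also have "\<dots> \<le> 2 * (real n / 8 + 1/4) + (5 * real n / 16 + 1/4) + (5 * real n / 16 + 1/4)"
    by (intro add_mono mult_left_mono sum_axis_weight_le sum_diag_weight_le) (use assms in auto)
  finally show ?thesis
    by simp
qed

section \<open>Covering every cell and conclusion\<close>

lemma cell_covered:
  assumes ij: "i \<in> {1..n}" "j \<in> {1..n}"
  shows "1 \<le> sum (line_weight n)
    {k \<in> Sigma dirs (offsets n). cell n i j \<in> snake n (case_prod (lattice_line n) k)}"
    (is "_ \<le> sum _ ?K")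
proof -
  define a where "a = 2 * int i - 1 - int n"
  define b where "b = 2 * int j - 1 - int n"
  \<comment> \<open>Diagonal offsets differ by 1 from the value at the centre, which is below
    \<open>\<bar>p\<bar> + \<bar>q\<bar> = 2\<close>, so these six lines all pierce the
    cell.\<close>
  define F where "F = {((1, 0), a), ((0, 1), b), ((1, 1), a + b - 1), ((1, 1), a + b + 1),
    ((1, -1), a - b - 1), ((1::int, -1::int), a - b + 1)}"
  have n: "n > 0"
    using ij by auto
  have ab: "\<bar>a\<bar> < int n" "\<bar>b\<bar> < int n"
    using ij by (auto simp: a_def b_def)
  have parity: "odd (a + int n)" "odd (b + int n)"
    by (auto simp: a_def b_def)
  have cell: "cell n i j \<in> chessboard n"
    using ij by (auto simp: chessboard_def)
  have pierced: "cell n i j \<in> snake n (lattice_line n (p, q) t)"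
    if "\<bar>t - (p * a + q * b)\<bar> < \<bar>p\<bar> + \<bar>q\<bar>" for p q t
    using that cell n lattice_line_pierces_cell by (auto simp: snake_def a_def b_def)
  have "F \<subseteq> Sigma dirs (offsets n)"
    using ab parity by (auto simp: F_def dirs_def offsets_def)
  moreover have "\<forall>k\<in>F. cell n i j \<in> snake n (case_prod (lattice_line n) k)"
    unfolding F_def by (auto intro!: pierced)
  ultimately have "F \<subseteq> ?K"
    by blast
  moreover have "finite ?K"
    by (auto simp: dirs_def finite_offsets intro!: finite_SigmaI)
  ultimately have "sum (line_weight n) F \<le> sum (line_weight n) ?K"
    by (intro sum_mono2) (auto simp: line_weight_nonneg)
  moreover have "sum (line_weight n) F = axis_weight n a + axis_weight n b
    + diag_weight n (a + b - 1) + diag_weight n (a + b + 1)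
    + diag_weight n (a - b - 1) + diag_weight n (a - b + 1)"
    by (simp add: F_def line_weight_def)
  ultimately show ?thesis
    using weights_cover[OF ab] by simp
qed

theorem theorem4:
  "\<forall>\<^sub>F n in sequentially.
     (\<exists>\<rho> :: (real \<times> real) set set \<Rightarrow> real.
        \<rho> \<in> snakes n \<rightarrow> {0..} \<and>
        (\<forall>i\<in>{1..n}. \<forall>j\<in>{1..n}. (\<Sum>\<sigma> | \<sigma> \<in> snakes n \<and> cell n i j \<in> \<sigma>. \<rho> \<sigma>) \<ge> 1) \<and>
        (\<Sum>\<sigma>\<in>snakes n. \<rho> \<sigma>) < 0.925 * real n) \<and>
     LPc_value n < ereal (0.925 * real n)"
  using eventually_gt_at_top[of 20]
proof eventually_elim
  fix n :: nat
  \<comment> \<open>The threshold is where \<open>7 * n / 8 + 1\<close> drops below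
    \<open>0.925 * n\<close>, that is \<open>0.05 * n > 1\<close>.\<close>
  assume n: "20 < n"
  let ?I = "Sigma dirs (offsets n)"
  let ?l = "case_prod (lattice_line n)"
  have fin: "finite ?I"
    by (auto simp: dirs_def finite_offsets)
  have line: "\<forall>k\<in>?I. is_line (?l k)"
    by (auto simp: dirs_def zero_prod_def intro!: is_line_lattice_line)
  have meet: "\<forall>k\<in>?I. ?l k \<inter> ({-1..1} \<times> {-1..1}) \<noteq> {}"
  proof
    fix k
    assume k: "k \<in> ?I"
    obtain p q t where "k = ((p, q), t)"
      by (metis surj_pair)
    with k n show "?l k \<inter> ({-1..1} \<times> {-1..1}) \<noteq> {}"
      using lattice_line_meets_board[of n p q t] by (auto simp: dirs_def offsets_def)
  qed
  obtain \<rho> where \<rho>: "\<rho> \<in> snakes n \<rightarrow> {0..}"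
    and total: "(\<Sum>\<sigma>\<in>snakes n. \<rho> \<sigma>) = sum (line_weight n) ?I"
    and cover: "\<And>c. (\<Sum>\<sigma> | \<sigma> \<in> snakes n \<and> c \<in> \<sigma>. \<rho> \<sigma>) =
      sum (line_weight n) {k \<in> ?I. c \<in> snake n (?l k)}"
    using snake_weights_of_lines[OF fin line meet, of "line_weight n" n] line_weight_nonneg by blast
  have covers: "\<forall>i\<in>{1..n}. \<forall>j\<in>{1..n}. (\<Sum>\<sigma> | \<sigma> \<in> snakes n \<and> cell n i j \<in> \<sigma>. \<rho> \<sigma>) \<ge> 1"
    unfolding cover using cell_covered by blast
  have less: "(\<Sum>\<sigma>\<in>snakes n. \<rho> \<sigma>) < 0.925 * real n"
    using sum_line_weight_le[of n] n by (simp add: total)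
  have "LPc_value n \<le> ereal (LPc_objective n \<rho>)"
    unfolding LPc_value_def using \<rho> covers by (intro INF_lower) (simp add: LPc_feasible_def)
  with less have "LPc_value n < ereal (0.925 * real n)"
    by (simp add: LPc_objective_def le_less_trans)
  with \<rho> covers less show "(\<exists>\<rho> :: (real \<times> real) set set \<Rightarrow> real.
        \<rho> \<in> snakes n \<rightarrow> {0..} \<and>
        (\<forall>i\<in>{1..n}. \<forall>j\<in>{1..n}. (\<Sum>\<sigma> | \<sigma> \<in> snakes n \<and> cell n i j \<in> \<sigma>. \<rho> \<sigma>) \<ge> 1) \<and>
        (\<Sum>\<sigma>\<in>snakes n. \<rho> \<sigma>) < 0.925 * real n) \<and>
     LPc_value n < ereal (0.925 * real n)"
    by blast
qed

end
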